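(* Let $A\in\mathbb{R}^{m\times n}$ ($m,n\ge 1$) have no zero rows and let $r=\mathrm{rank}(A)$. Let $\hat A$ be its row-normalized form, with rows $\hat a_1,\dots,\hat a_m$, and let $L$ be the lower triangular matrix defined in the context. Then $$\|L-I_m\|_{\mathrm{op}}^2\le\min\Big\{\sum_{1\le i<j\le m}\langle\hat a_i,\hat a_j\rangle^2,\ \Big(\frac{\lceil\log_2(r)\rceil}{2}+1\Big)^2\sigma_1^4(\hat A)\Big\}.$$
   Context: $\|\cdot\|$ is the Euclidean norm on vectors and $\|\cdot\|_{\mathrm{op}}$ the induced operator (spectral) norm on matrices; $I_m$ is the $m\times m$ identity. The rows of $A$ are $a_1,\dots,a_m\in\mathbb{R}^n$, $\hat a_i=a_i/\|a_i\|$, and $\hat A\in\mathbb{R}^{m\times n}$ is the matrix with rows $\hat a_i$. $\sigma_1(\hat A)$ is the largest singular value of $\hat A$. $L\in\mathbb{R}^{m\times m}$ is the unit lower triangular matrix with $L_{ij}=\langle\hat a_i,\hat a_j\rangle$ for $j<i$, $L_{ii}=1$, $L_{ij}=0$ for $j>i$. *)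

theory Defs
  imports "HOL-Analysis.Analysis"
begin

definition normalize_rows :: "real^'n^'m \<Rightarrow> real^'n^'m" where
  "normalize_rows A = (\<chi> i. row i A /\<^sub>R norm (row i A))"

text \<open>
  The row index type carries a linear order, so that it plays the role of
  $1 < 2 < \dots < m$; the triangular shape below refers to that order.
\<close>

definition lower_gram :: "real^'n^'m::{finite,linorder} \<Rightarrow> real^'m::{finite,linorder}^'m::{finite,linorder}" where
  "lower_gram A = (\<chi> i j.
     if j < i then row i (normalize_rows A) \<bullet> row j (normalize_rows A)
     else if i = j then 1 else 0)"

text \<open>
  Singular values are the nonnegative square roots of the eigenvalues of
  $A^T A$. If $m < n$ this adds the value $0$ to the square roots of the
  eigenvalues of $A A^T$, which does not affect the largest one. The set is
  finite and nonempty, so \<^const>\<open>Max\<close> is meaningful on it.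
\<close>

definition singular_values :: "real^'n^'m \<Rightarrow> real set" where
  "singular_values A =
     {sqrt \<mu> |\<mu>. \<exists>v. v \<noteq> 0 \<and> (transpose A ** A) *v v = \<mu> *\<^sub>R v}"

definition largest_singular_value :: "real^'n^'m \<Rightarrow> real" where
  "largest_singular_value A = Max (singular_values A)"

end

theory Submission
  imports Defs
begin

text \<open>
  Let $\lambda = \sigma_1(\hat A)^2$. Comparing traces, $m = \sum_i \|\hat a_i\|^2 \le r \lambda$, so
  cutting the rows into $r$ consecutive blocks of size $s = \lfloor (m-1)/r \rfloor + 1$ gives
  $s - 1 \le \lambda$. The part of $L - I$ inside the blocks has at most $s - 1$ entries in each
  row and column, each of modulus at most $1$, so its norm is at most $\lambda$. The part outside
  the blocks is split dyadically into $\lceil \log_2 r \rceil$ levels. Each level is a direct sum of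
  off-diagonal corners of principal submatrices of the positive semidefinite matrix
  $\hat A \hat A^T$, and such a corner has norm at most $\lambda / 2$.
  All bounds are carried as bounds of $\langle x, M y\rangle$ by a multiple of
  $\|x\|^2 + \|y\|^2$, which add up without any Cauchy-Schwarz argument.
\<close>

section \<open>The largest singular value\<close>

lemma inner_transpose_mult:
  fixes B :: "real^'n^'m"
  shows "x \<bullet> ((transpose B ** B) *v y) = (B *v x) \<bullet> (B *v y)"
  by (metis dot_lmul_matrix matrix_vector_mul_assoc transpose_matrix_vector inner_commute)

lemma eigenvectors_orthogonal:
  fixes B :: "real^'n^'m"
  assumes "(transpose B ** B) *v v = \<mu> *\<^sub>R v" "(transpose B ** B) *v w = \<nu> *\<^sub>R w" "\<mu> \<noteq> \<nu>"
  shows "orthogonal v w"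
proof -
  have "\<nu> * (v \<bullet> w) = \<mu> * (v \<bullet> w)"
    using inner_transpose_mult[of v B w] inner_transpose_mult[of w B v] assms
    by (simp add: inner_commute)
  with assms(3) show ?thesis by (simp add: orthogonal_def)
qed

text \<open>\<open>Max\<close> is only informative on a finite set. Eigenvectors chosen for distinct
  eigenvalues are nonzero and pairwise orthogonal, hence independent, hence finitely many.\<close>

lemma finite_singular_values:
  fixes B :: "real^'n^'m"
  shows "finite (singular_values B)"
proof -
  define E where "E = {\<mu>. \<exists>v. v \<noteq> 0 \<and> (transpose B ** B) *v v = \<mu> *\<^sub>R v}"
  define f where "f \<mu> = (SOME v. v \<noteq> 0 \<and> (transpose B ** B) *v v = \<mu> *\<^sub>R v)" for \<mu>
  have f: "f \<mu> \<noteq> 0 \<and> (transpose B ** B) *v f \<mu> = \<mu> *\<^sub>R f \<mu>" if "\<mu> \<in> E" for \<mu>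
  proof -
    from that have "\<exists>v. v \<noteq> 0 \<and> (transpose B ** B) *v v = \<mu> *\<^sub>R v" by (simp add: E_def)
    then show ?thesis unfolding f_def by (rule someI_ex)
  qed
  have "inj_on f E"
    by (metis f inj_onI scaleR_cancel_right)
  moreover have "pairwise orthogonal (f ` E)"
    unfolding pairwise_def by (metis (no_types, lifting) eigenvectors_orthogonal f imageE)
  then have "finite (f ` E)"
    using f by (intro independent_imp_finite pairwise_orthogonal_independent) auto
  ultimately have "finite E"
    using finite_image_iff by blast
  then show ?thesis
    unfolding singular_values_def E_def[symmetric]
    by (simp add: setcompr_eq_image flip: E_def)
qed

text \<open>A maximizer \<open>v\<close> of the Rayleigh quotient is an eigenvector: the quadratic function
  \<open>t \<mapsto> \<mu> |v + t w|\<^sup>2 - |B (v + t w)|\<^sup>2\<close> is nonnegative and vanishes at \<open>0\<close>, so its linear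
  coefficient vanishes.\<close>

lemma rayleigh_maximizer:
  fixes B :: "real^'n^'m"
  obtains v \<mu> where "v \<noteq> 0" "(transpose B ** B) *v v = \<mu> *\<^sub>R v" "0 \<le> \<mu>"
    "\<And>w. (norm (B *v w))\<^sup>2 \<le> \<mu> * (norm w)\<^sup>2"
proof -
  have "continuous_on (sphere 0 1) (\<lambda>v. (norm (B *v v))\<^sup>2)"
    by (intro continuous_intros linear_continuous_on) (simp add: linear_linear)
  moreover have "sphere 0 1 \<noteq> ({} :: (real^'n) set)" by simp
  ultimately obtain v where "v \<in> sphere 0 1"
    "\<forall>w\<in>sphere 0 1. (norm (B *v w))\<^sup>2 \<le> (norm (B *v v))\<^sup>2"
    using continuous_attains_sup[OF compact_sphere] by blast
  then have v: "norm v = 1"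
    and vmax: "\<And>w. norm w = 1 \<Longrightarrow> (norm (B *v w))\<^sup>2 \<le> (norm (B *v v))\<^sup>2"
    by simp_all
  define \<mu> where "\<mu> = (norm (B *v v))\<^sup>2"
  have bound: "(norm (B *v w))\<^sup>2 \<le> \<mu> * (norm w)\<^sup>2" for w
  proof (cases "w = 0")
    case False
    have "B *v w = norm w *\<^sub>R (B *v (w /\<^sub>R norm w))"
      using False by (simp add: matrix_vector_mult_scaleR)
    then have "(norm (B *v w))\<^sup>2 = (norm w)\<^sup>2 * (norm (B *v (w /\<^sub>R norm w)))\<^sup>2"
      by (metis abs_norm_cancel norm_scaleR power_mult_distrib)
    also have "\<dots> \<le> (norm w)\<^sup>2 * \<mu>"
      unfolding \<mu>_def using False by (intro mult_left_mono vmax) auto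
    finally show ?thesis by (simp add: mult.commute)
  qed simp
  define g where "g = \<mu> *\<^sub>R v - (transpose B ** B) *v v"
  have g_inner: "g \<bullet> w = \<mu> * (v \<bullet> w) - (B *v v) \<bullet> (B *v w)" for w
    unfolding g_def using inner_transpose_mult[of w B v] by (simp add: inner_diff_left inner_diff_right inner_commute)
  have "g = 0"
  proof (rule ccontr)
    assume "g \<noteq> 0"
    define c where "c = \<mu> * (norm g)\<^sup>2 - (norm (B *v g))\<^sup>2"
    have c: "0 \<le> c" unfolding c_def using bound[of g] by simp
    \<comment> \<open>The direction is \<open>g\<close> itself, because there the linear coefficient
      becomes \<open>2 * (norm g)^2\<close>, which is positive unless \<open>g = 0\<close>.\<close>
    have quad: "0 \<le> 2 * t * (norm g)\<^sup>2 + t\<^sup>2 * c" for t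
    proof -
      have "(norm (v + t *\<^sub>R g))\<^sup>2 = 1 + 2 * t * (v \<bullet> g) + t\<^sup>2 * (norm g)\<^sup>2"
        using v unfolding power2_norm_eq_inner norm_eq_1
        by (simp add: inner_add_left inner_add_right inner_commute power2_eq_square algebra_simps)
      moreover have "(norm (B *v (v + t *\<^sub>R g)))\<^sup>2
          = \<mu> + 2 * t * ((B *v v) \<bullet> (B *v g)) + t\<^sup>2 * (norm (B *v g))\<^sup>2"
        unfolding \<mu>_def power2_norm_eq_inner
        by (simp add: inner_add_left inner_add_right inner_commute power2_eq_square algebra_simps
            matrix_vector_right_distrib matrix_vector_mult_scaleR)
      moreover have "(norm g)\<^sup>2 = \<mu> * (v \<bullet> g) - (B *v v) \<bullet> (B *v g)"
        using g_inner[of g] by (simp add: power2_norm_eq_inner)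
      then have "2 * t * (norm g)\<^sup>2 = 2 * t * \<mu> * (v \<bullet> g) - 2 * t * ((B *v v) \<bullet> (B *v g))"
        by (simp only: right_diff_distrib mult.assoc)
      ultimately show ?thesis
        using bound[of "v + t *\<^sub>R g"] unfolding c_def
        by (simp only: distrib_left right_diff_distrib mult.assoc mult.left_commute)
    qed
    have g2: "0 < (norm g)\<^sup>2" using \<open>g \<noteq> 0\<close> by simp
    \<comment> \<open>The minimizer would have denominator \<open>c\<close>; using
      \<open>c + 1\<close> also covers \<open>c = 0\<close> and still gives the negative value
      \<open>- (t^2) * (c + 2)\<close>.\<close>
    define t where "t = - (norm g)\<^sup>2 / (c + 1)"
    have t: "t * (c + 1) = - (norm g)\<^sup>2" unfolding t_def using c by simp
    have "2 * t * (norm g)\<^sup>2 + t\<^sup>2 * c = - t\<^sup>2 * (c + 2)"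
      using t by (simp add: power2_eq_square algebra_simps) algebra
    moreover have "t \<noteq> 0" using t g2 by auto
    ultimately show False using quad[of t] c
      by (smt (verit) mult_minus_left mult_pos_pos zero_less_power2)
  qed
  then show ?thesis using that[of v \<mu>] v bound unfolding g_def \<mu>_def by fastforce
qed

text \<open>The maximum of the Rayleigh quotient is an eigenvalue, so its square root is among the
  values over which \<open>Max\<close> is taken.\<close>

lemma largest_singular_value_bound:
  fixes B :: "real^'n^'m"
  shows "0 \<le> largest_singular_value B"
    and "(norm (B *v w))\<^sup>2 \<le> (largest_singular_value B)\<^sup>2 * (norm w)\<^sup>2"
proof -
  obtain v \<mu> where v: "v \<noteq> 0" "(transpose B ** B) *v v = \<mu> *\<^sub>R v" "0 \<le> \<mu>"
    and bound: "\<And>w. (norm (B *v w))\<^sup>2 \<le> \<mu> * (norm w)\<^sup>2"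
    using rayleigh_maximizer[of B] by blast
  have "sqrt \<mu> \<in> singular_values B"
    unfolding singular_values_def using v by blast
  then have le: "sqrt \<mu> \<le> largest_singular_value B"
    unfolding largest_singular_value_def by (intro Max_ge finite_singular_values)
  then show "0 \<le> largest_singular_value B"
    using v(3) by (meson order_trans real_sqrt_ge_zero)
  have "\<mu> \<le> (largest_singular_value B)\<^sup>2"
    using le v(3) by (meson real_sqrt_le_iff sqrt_le_D)
  then show "(norm (B *v w))\<^sup>2 \<le> (largest_singular_value B)\<^sup>2 * (norm w)\<^sup>2"
    using bound[of w] by (meson mult_right_mono order_trans zero_le_power2)
qed

text \<open>By Cauchy-Schwarz applied to \<open>|B^T u|^2 = <u, B B^T u>\<close>, after which one
  factor \<open>|B^T u|^2\<close> cancels. This turns a bound on \<open>B\<close> into one on linear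
  combinations of its rows.\<close>

lemma transpose_mult_bound:
  fixes B :: "real^'n^'m"
  assumes "\<And>w. (norm (B *v w))\<^sup>2 \<le> l * (norm w)\<^sup>2"
  shows "(norm (transpose B *v u))\<^sup>2 \<le> l * (norm u)\<^sup>2"
proof (cases "transpose B *v u = 0")
  case True
  \<comment> \<open>Testing the hypothesis on a unit vector supplies the sign of
    \<open>l\<close>.\<close>
  have "0 \<le> l * (norm (axis undefined 1 :: real^'n))\<^sup>2"
    using assms by (meson order_trans zero_le_power2)
  then show ?thesis using True by simp
next
  case False
  define z where "z = transpose B *v u"
  have "(norm z)\<^sup>2 = u \<bullet> (B *v z)"
    unfolding z_def by (simp add: power2_norm_eq_inner transpose_matrix_vector dot_lmul_matrix)
  also have "\<dots> \<le> norm u * norm (B *v z)" by (rule norm_cauchy_schwarz)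
  finally have "((norm z)\<^sup>2)\<^sup>2 \<le> (norm u)\<^sup>2 * (norm (B *v z))\<^sup>2"
    by (metis power_mono power_mult_distrib zero_le_power2)
  also have "\<dots> \<le> (norm u)\<^sup>2 * (l * (norm z)\<^sup>2)"
    by (intro mult_left_mono assms) simp
  finally have "(norm z)\<^sup>2 * (norm z)\<^sup>2 \<le> (l * (norm u)\<^sup>2) * (norm z)\<^sup>2"
    by (simp add: power2_eq_square algebra_simps)
  moreover have "0 < (norm z)\<^sup>2" using False by (simp add: z_def)
  ultimately show ?thesis unfolding z_def by (rule mult_right_le_imp_le)
qed

section \<open>Sums over the lower triangle\<close>

lemma four_inner_le_norm_add_power2:
  fixes p q :: "'v::real_inner"
  shows "4 * (p \<bullet> q) \<le> (norm (p + q))\<^sup>2"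
proof -
  have "0 \<le> (norm (p - q))\<^sup>2" by simp
  then show ?thesis
    by (simp add: power2_norm_eq_inner inner_add_left inner_add_right inner_diff_left
        inner_diff_right inner_commute)
qed

text \<open>The two halves of the pairs joined when the blocks \<open>2c\<close> and \<open>2c+1\<close> are merged have disjoint
  supports, so polarization gives the constant \<open>l / 4\<close>.\<close>

lemma merge_level_bound:
  fixes a :: "'m::finite \<Rightarrow> 'v::real_inner" and b :: "'m \<Rightarrow> nat"
  assumes "\<And>w. (norm (\<Sum>i\<in>UNIV. w i *\<^sub>R a i))\<^sup>2 \<le> l * (\<Sum>i\<in>UNIV. (w i)\<^sup>2)" and "0 \<le> l"
  shows "(\<Sum>i\<in>UNIV. \<Sum>j\<in>UNIV. if odd (b i) \<and> even (b j) \<and> b i div 2 = b j div 2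
            then x i * y j * (a i \<bullet> a j) else 0)
    \<le> l / 4 * (\<Sum>i\<in>UNIV. (x i)\<^sup>2 + (y i)\<^sup>2)"
proof -
  define C where "C = range (\<lambda>i. b i div 2)"
  \<comment> \<open>\<open>p c\<close> restricts \<open>x\<close> to the odd half and
    \<open>q c\<close> restricts \<open>y\<close> to the even half of the merged block
    \<open>c\<close>; summing over \<open>c\<close> splits the double sum into inner
    products.\<close>
  define p where "p c i = (if b i div 2 = c \<and> odd (b i) then x i else 0)" for c i
  define q where "q c i = (if b i div 2 = c \<and> even (b i) then y i else 0)" for c i
  have [simp]: "finite C" "b i div 2 \<in> C" for i unfolding C_def by auto
  have pq: "(\<Sum>c\<in>C. p c i * q c j) =
      (if odd (b i) \<and> even (b j) \<and> b i div 2 = b j div 2 then x i * y j else 0)" for i j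
  proof -
    have "(\<Sum>c\<in>C. p c i * q c j) = (\<Sum>c\<in>C. if c = b i div 2 then p c i * q c j else 0)"
      by (intro sum.cong) (auto simp: p_def)
    also have "\<dots> = p (b i div 2) i * q (b i div 2) j" by (simp add: sum.delta')
    finally show ?thesis by (simp add: p_def q_def)
  qed
  have sq: "(\<Sum>c\<in>C. (p c i + q c i)\<^sup>2) \<le> (x i)\<^sup>2 + (y i)\<^sup>2" for i
  proof -
    have "(\<Sum>c\<in>C. (p c i + q c i)\<^sup>2) = (\<Sum>c\<in>C. if c = b i div 2 then (p c i + q c i)\<^sup>2 else 0)"
      by (intro sum.cong) (auto simp: p_def q_def)
    also have "\<dots> = (p (b i div 2) i + q (b i div 2) i)\<^sup>2" by (simp add: sum.delta')
    \<comment> \<open>At most one of \<open>p\<close> and \<open>q\<close> is nonzero at a given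
      index, so no cross term \<open>x i * y i\<close> arises.\<close>
    also have "\<dots> \<le> (x i)\<^sup>2 + (y i)\<^sup>2" by (simp add: p_def q_def)
    finally show ?thesis .
  qed
  have "(\<Sum>i\<in>UNIV. \<Sum>j\<in>UNIV. if odd (b i) \<and> even (b j) \<and> b i div 2 = b j div 2
            then x i * y j * (a i \<bullet> a j) else 0)
      = (\<Sum>i\<in>UNIV. \<Sum>j\<in>UNIV. \<Sum>c\<in>C. p c i * q c j * (a i \<bullet> a j))"
    by (intro sum.cong refl) (simp add: pq flip: sum_distrib_right)
  also have "\<dots> = (\<Sum>i\<in>UNIV. \<Sum>c\<in>C. \<Sum>j\<in>UNIV. p c i * q c j * (a i \<bullet> a j))"
    by (intro sum.cong refl sum.swap)
  also have "\<dots> = (\<Sum>c\<in>C. \<Sum>i\<in>UNIV. \<Sum>j\<in>UNIV. p c i * q c j * (a i \<bullet> a j))"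
    by (rule sum.swap)
  also have "\<dots> = (\<Sum>c\<in>C. (\<Sum>i\<in>UNIV. p c i *\<^sub>R a i) \<bullet> (\<Sum>j\<in>UNIV. q c j *\<^sub>R a j))"
    by (simp only: inner_sum_left inner_scaleR_left)
      (simp add: inner_sum_right sum_distrib_left mult.assoc)
  also have "\<dots> \<le> (\<Sum>c\<in>C. l / 4 * (\<Sum>i\<in>UNIV. (p c i + q c i)\<^sup>2))"
  proof (intro sum_mono)
    fix c
    let ?P = "\<Sum>i\<in>UNIV. p c i *\<^sub>R a i" and ?Q = "\<Sum>i\<in>UNIV. q c i *\<^sub>R a i"
    have "4 * (?P \<bullet> ?Q) \<le> (norm (?P + ?Q))\<^sup>2" by (rule four_inner_le_norm_add_power2)
    also have "?P + ?Q = (\<Sum>i\<in>UNIV. (p c i + q c i) *\<^sub>R a i)"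
      by (simp add: scaleR_add_left sum.distrib)
    also have "(norm \<dots>)\<^sup>2 \<le> l * (\<Sum>i\<in>UNIV. (p c i + q c i)\<^sup>2)" by (rule assms(1))
    finally show "?P \<bullet> ?Q \<le> l / 4 * (\<Sum>i\<in>UNIV. (p c i + q c i)\<^sup>2)" by simp
  qed
  also have "\<dots> = l / 4 * (\<Sum>i\<in>UNIV. \<Sum>c\<in>C. (p c i + q c i)\<^sup>2)"
    unfolding sum_distrib_left[symmetric] by (subst sum.swap) (rule refl)
  also have "\<dots> \<le> l / 4 * (\<Sum>i\<in>UNIV. (x i)\<^sup>2 + (y i)\<^sup>2)"
    using assms(2) by (intro mult_left_mono sum_mono sq) auto
  finally show ?thesis .
qed

text \<open>The map \<open>b\<close> labels the blocks. A constant label gives the full bilinear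
  form of the strictly lower triangle, and halving labels merges neighbouring blocks, so the dyadic
  levels need no index sets of their own.\<close>

definition block_lower_sum ::
  "('m::{finite,linorder} \<Rightarrow> 'v::real_inner) \<Rightarrow> ('m \<Rightarrow> nat) \<Rightarrow> ('m \<Rightarrow> real) \<Rightarrow> ('m \<Rightarrow> real) \<Rightarrow> real" where
  "block_lower_sum a b x y =
    (\<Sum>i\<in>UNIV. \<Sum>j\<in>UNIV. if j < i \<and> b i = b j then x i * y j * (a i \<bullet> a j) else 0)"

text \<open>The pairs gained by merging have labels \<open>2c+1\<close> for \<open>i\<close> and
  \<open>2c\<close> for \<open>j\<close>; for these, monotonicity makes \<open>j < i\<close>
  automatic, so the gain is the corner sum of \<open>merge_level_bound\<close>.\<close>

lemma block_lower_sum_merge: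
  fixes a :: "'m::{finite,linorder} \<Rightarrow> 'v::real_inner"
  assumes "\<And>w. (norm (\<Sum>i\<in>UNIV. w i *\<^sub>R a i))\<^sup>2 \<le> l * (\<Sum>i\<in>UNIV. (w i)\<^sup>2)" and "0 \<le> l"
    and "mono b"
  shows "block_lower_sum a (\<lambda>i. b i div 2) x y
    \<le> block_lower_sum a b x y + l / 4 * (\<Sum>i\<in>UNIV. (x i)\<^sup>2 + (y i)\<^sup>2)"
proof -
  have "(j < i \<and> b i div 2 = b j div 2) \<longleftrightarrow>
      (j < i \<and> b i = b j) \<or> (odd (b i) \<and> even (b j) \<and> b i div 2 = b j div 2)" for i j
  proof (cases "j < i")
    case True
    then have "b j \<le> b i" using assms(3) by (simp add: monoD)
    then show ?thesis using True by presburger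
  next
    case False
    then have "b i \<le> b j" using assms(3) by (simp add: monoD)
    then show ?thesis using False by presburger
  qed
  then have "block_lower_sum a (\<lambda>i. b i div 2) x y = block_lower_sum a b x y +
      (\<Sum>i\<in>UNIV. \<Sum>j\<in>UNIV. if odd (b i) \<and> even (b j) \<and> b i div 2 = b j div 2
            then x i * y j * (a i \<bullet> a j) else 0)"
    unfolding block_lower_sum_def sum.distrib[symmetric] by (intro sum.cong refl) auto
  then show ?thesis using merge_level_bound[OF assms(1,2), where b = b and x = x and y = y] by simp
qed

lemma block_lower_sum_merges:
  fixes a :: "'m::{finite,linorder} \<Rightarrow> 'v::real_inner"
  assumes "\<And>w. (norm (\<Sum>i\<in>UNIV. w i *\<^sub>R a i))\<^sup>2 \<le> l * (\<Sum>i\<in>UNIV. (w i)\<^sup>2)" and "0 \<le> l"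
    and "mono b"
  shows "block_lower_sum a (\<lambda>i. b i div 2 ^ k) x y
    \<le> block_lower_sum a b x y + real k * (l / 4) * (\<Sum>i\<in>UNIV. (x i)\<^sup>2 + (y i)\<^sup>2)"
proof (induction k)
  case (Suc k)
  have "mono (\<lambda>i. b i div 2 ^ k)"
    using assms(3) by (simp add: mono_def div_le_mono)
  from block_lower_sum_merge[OF assms(1,2) this, where x = x and y = y] Suc show ?case
    unfolding power_Suc2 div_mult2_eq of_nat_Suc distrib_right by simp
qed simp

text \<open>A Schur-type estimate: the arithmetic-geometric mean inequality splits each term between
  \<open>x i\<close> and \<open>y j\<close>. Relaxing \<open>j < i\<close> to
  \<open>j \<noteq> i\<close> makes the condition symmetric, so one count serves rows and
  columns.\<close>

lemma block_lower_sum_within: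
  fixes a :: "'m::{finite,linorder} \<Rightarrow> 'v::real_inner"
  assumes "\<And>i. norm (a i) = 1" and "\<And>i. real (card {j. j \<noteq> i \<and> b j = b i}) \<le> d"
  shows "block_lower_sum a b x y \<le> d / 2 * (\<Sum>i\<in>UNIV. (x i)\<^sup>2 + (y i)\<^sup>2)"
proof -
  have term_le: "(if j < i \<and> b i = b j then x i * y j * (a i \<bullet> a j) else 0)
      \<le> (if j \<noteq> i \<and> b j = b i then (x i)\<^sup>2 / 2 else 0) + (if i \<noteq> j \<and> b i = b j then (y j)\<^sup>2 / 2 else 0)"
    for i j
  proof -
    have "\<bar>a i \<bullet> a j\<bar> \<le> 1" using Cauchy_Schwarz_ineq2[of "a i" "a j"] by (simp add: assms(1))
    then have "\<bar>x i * y j * (a i \<bullet> a j)\<bar> \<le> \<bar>x i\<bar> * \<bar>y j\<bar>"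
      by (simp add: abs_mult mult_left_le)
    then have "x i * y j * (a i \<bullet> a j) \<le> \<bar>x i\<bar> * \<bar>y j\<bar>" by linarith
    moreover have "2 * (\<bar>x i\<bar> * \<bar>y j\<bar>) \<le> (x i)\<^sup>2 + (y j)\<^sup>2"
      using sum_squares_bound[of "\<bar>x i\<bar>" "\<bar>y j\<bar>"] by (simp add: mult.assoc)
    ultimately show ?thesis by auto
  qed
  have row_le: "(\<Sum>j\<in>UNIV. if j \<noteq> i \<and> b j = b i then (z i)\<^sup>2 / 2 else 0) \<le> d / 2 * (z i)\<^sup>2" for i z
  proof -
    have "(\<Sum>j\<in>UNIV. if j \<noteq> i \<and> b j = b i then (z i)\<^sup>2 / 2 else 0)
        = real (card {j. j \<noteq> i \<and> b j = b i}) * ((z i)\<^sup>2 / 2)"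
      by (simp flip: sum.inter_filter)
    also have "\<dots> \<le> d * ((z i)\<^sup>2 / 2)" by (intro mult_right_mono assms(2)) simp
    finally show ?thesis by simp
  qed
  have "block_lower_sum a b x y
      \<le> (\<Sum>i\<in>UNIV. \<Sum>j\<in>UNIV. if j \<noteq> i \<and> b j = b i then (x i)\<^sup>2 / 2 else 0)
        + (\<Sum>i\<in>UNIV. \<Sum>j\<in>UNIV. if i \<noteq> j \<and> b i = b j then (y j)\<^sup>2 / 2 else 0)"
    unfolding block_lower_sum_def sum.distrib[symmetric] by (intro sum_mono term_le)
  also have "\<dots> = (\<Sum>i\<in>UNIV. \<Sum>j\<in>UNIV. if j \<noteq> i \<and> b j = b i then (x i)\<^sup>2 / 2 else 0)
        + (\<Sum>i\<in>UNIV. \<Sum>j\<in>UNIV. if j \<noteq> i \<and> b j = b i then (y i)\<^sup>2 / 2 else 0)"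
    by (subst (3) sum.swap) (rule refl)
  also have "\<dots> \<le> (\<Sum>i\<in>UNIV. d / 2 * (x i)\<^sup>2) + (\<Sum>i\<in>UNIV. d / 2 * (y i)\<^sup>2)"
    by (intro add_mono sum_mono row_le)
  also have "\<dots> = d / 2 * (\<Sum>i\<in>UNIV. (x i)\<^sup>2 + (y i)\<^sup>2)"
    by (simp add: sum.distrib sum_distrib_left distrib_left)
  finally show ?thesis .
qed

text \<open>The blocks contribute \<open>l / 2\<close> and each of the \<open>k\<close> merges
  \<open>l / 4\<close>, whence the constant. As \<open>r\<close> need not be a power of two, some
  merges may meet empty blocks.\<close>

lemma strictly_lower_sum_bound:
  fixes a :: "'m::{finite,linorder} \<Rightarrow> 'v::real_inner"
  assumes "\<And>w. (norm (\<Sum>i\<in>UNIV. w i *\<^sub>R a i))\<^sup>2 \<le> l * (\<Sum>i\<in>UNIV. (w i)\<^sup>2)" and "0 \<le> l"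
    and "\<And>i. norm (a i) = 1"
    and "real CARD('m) \<le> real r * l" and "0 < r" and "r \<le> 2 ^ k"
  shows "(\<Sum>i\<in>UNIV. \<Sum>j\<in>UNIV. if j < i then x i * y j * (a i \<bullet> a j) else 0)
    \<le> (real k / 2 + 1) * l / 2 * (\<Sum>i\<in>UNIV. (x i)\<^sup>2 + (y i)\<^sup>2)"
proof -
  define idx where "idx i = card {j::'m. j < i}" for i
  \<comment> \<open>This is \<open>CARD('m) / r\<close> rounded up: \<open>r\<close> blocks of this
    size cover all rows, while \<open>s - 1\<close> is still at most \<open>l\<close>.\<close>
  define s where "s = (CARD('m) - 1) div r + 1"
  define b where "b i = idx i div s" for i
  have idx_less: "idx i < idx j" if "i < j" for i j
    unfolding idx_def using that by (intro psubset_card_mono) auto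
  have idx_lt: "idx i < CARD('m)" for i
    unfolding idx_def by (intro psubset_card_mono) auto
  have s0: "0 < s" unfolding s_def by simp
  have "mono b"
    unfolding b_def mono_def by (metis div_le_mono idx_less le_less)
  have "inj idx"
    by (metis idx_less injI less_irrefl linorder_neqE)
  have b_lt: "b i < 2 ^ k" for i
  proof -
    have "CARD('m) \<le> s * r"
    proof -
      have "CARD('m) - 1 < ((CARD('m) - 1) div r + 1) * r"
        using \<open>0 < r\<close> by (metis Suc_eq_plus1 dividend_less_div_times mult_Suc add.commute)
      then show ?thesis unfolding s_def by linarith
    qed
    then have "b i < r" unfolding b_def
      using idx_lt[of i] by (intro less_mult_imp_div_less) (simp add: mult.commute)
    then show ?thesis using assms(6) by simp
  qed
  have card_block: "real (card {j. j \<noteq> i \<and> b j = b i}) \<le> l" for i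
  proof -
    \<comment> \<open>A block occupies positions in an interval of length \<open>s\<close>; leaving
      out \<open>idx i\<close> improves the count from \<open>s\<close> to
      \<open>s - 1\<close>.\<close>
    have "idx ` {j. j \<noteq> i \<and> b j = b i} \<subseteq> {b i * s..<b i * s + s} - {idx i}"
    proof
      fix n assume "n \<in> idx ` {j. j \<noteq> i \<and> b j = b i}"
      then obtain j where j: "n = idx j" "j \<noteq> i" "b j = b i" by auto
      have "idx j = b i * s + idx j mod s"
        using j(3) unfolding b_def by (metis div_mult_mod_eq)
      moreover have "idx j mod s < s" using s0 by simp
      moreover have "idx j \<noteq> idx i" using \<open>inj idx\<close> j(2) by (simp add: inj_eq)
      ultimately show "n \<in> {b i * s..<b i * s + s} - {idx i}" using j(1) by auto
    qed
    then have "card {j. j \<noteq> i \<and> b j = b i} \<le> card ({b i * s..<b i * s + s} - {idx i})"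
      by (intro card_inj_on_le[where f = idx] inj_on_subset[OF \<open>inj idx\<close>]) auto
    moreover have "idx i \<in> {b i * s..<b i * s + s}"
      using s0 unfolding b_def by (simp add: dividend_less_div_times)
         (metis add.commute dividend_less_div_times)
    ultimately have "card {j. j \<noteq> i \<and> b j = b i} \<le> (CARD('m) - 1) div r"
      by (simp add: s_def)
    then have "real (card {j. j \<noteq> i \<and> b j = b i}) \<le> real ((CARD('m) - 1) div r)"
      by (rule of_nat_mono)
    also have "\<dots> \<le> real (CARD('m) - 1) / real r" by (rule of_nat_div_le_of_nat)
    also have "\<dots> \<le> l"
      using assms(4,5) by (simp add: divide_le_eq mult.commute)
    finally show ?thesis .
  qed
  have "block_lower_sum a (\<lambda>i. b i div 2 ^ k) x y
      \<le> block_lower_sum a b x y + real k * (l / 4) * (\<Sum>i\<in>UNIV. (x i)\<^sup>2 + (y i)\<^sup>2)"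
    by (rule block_lower_sum_merges[OF assms(1,2) \<open>mono b\<close>])
  also have "\<dots> \<le> l / 2 * (\<Sum>i\<in>UNIV. (x i)\<^sup>2 + (y i)\<^sup>2)
      + real k * (l / 4) * (\<Sum>i\<in>UNIV. (x i)\<^sup>2 + (y i)\<^sup>2)"
    by (intro add_right_mono block_lower_sum_within assms(3) card_block)
  also have "\<dots> = (real k / 2 + 1) * l / 2 * (\<Sum>i\<in>UNIV. (x i)\<^sup>2 + (y i)\<^sup>2)"
    by (simp add: field_simps)
  \<comment> \<open>All labels lie below \<open>2 ^ k\<close>, so \<open>k\<close> halvings send
    them to \<open>0\<close> and the block condition disappears.\<close>
  finally show ?thesis
    by (simp add: block_lower_sum_def b_lt)
qed

section \<open>Operator norms\<close>

lemma norm_vec_power2: "(norm v)\<^sup>2 = (\<Sum>i\<in>UNIV. (v $ i)\<^sup>2)" for v :: "real^'k"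
  by (simp add: norm_vec_def L2_set_def sum_nonneg)

text \<open>With \<open>x = (M *v y) /\<^sub>R c\<close>, half of \<open>|M y|^2 / c\<close> on the
  right is absorbed by the left side, so the symmetric form of the hypothesis loses nothing.\<close>

lemma onorm_le_of_inner_bound:
  fixes M :: "real^'n^'m"
  assumes "\<And>x y. x \<bullet> (M *v y) \<le> c / 2 * ((norm x)\<^sup>2 + (norm y)\<^sup>2)" and "0 < c"
  shows "onorm ((*v) M) \<le> c"
proof (rule onorm_le)
  fix y
  let ?z = "M *v y"
  have half: "s \<le> t" if "s \<le> (s + t) / 2" for s t :: real using that by simp
  have "(norm ?z)\<^sup>2 / c = (?z /\<^sub>R c) \<bullet> ?z"
    by (simp add: power2_norm_eq_inner divide_inverse)
  also have "(?z /\<^sub>R c) \<bullet> ?z \<le> c / 2 * ((norm (?z /\<^sub>R c))\<^sup>2 + (norm y)\<^sup>2)" by (rule assms(1))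
  also have "(norm (?z /\<^sub>R c))\<^sup>2 = (norm ?z)\<^sup>2 / c\<^sup>2"
    by (simp add: power_mult_distrib power_inverse divide_inverse)
  also have "c / 2 * ((norm ?z)\<^sup>2 / c\<^sup>2 + (norm y)\<^sup>2) = ((norm ?z)\<^sup>2 / c + c * (norm y)\<^sup>2) / 2"
    using assms(2) by (simp add: field_simps power2_eq_square)
  finally have "(norm ?z)\<^sup>2 / c \<le> c * (norm y)\<^sup>2" by (rule half)
  then have "(norm ?z)\<^sup>2 \<le> c\<^sup>2 * (norm y)\<^sup>2"
    using assms(2) by (simp add: pos_divide_le_eq power2_eq_square mult_ac)
  then show "norm ?z \<le> c * norm y"
    using assms(2) by (metis less_imp_le mult_nonneg_nonneg norm_ge_zero power2_le_imp_le power_mult_distrib)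
qed

text \<open>The Frobenius bound, by Cauchy-Schwarz in each row; it yields the first entry of the
  minimum.\<close>

lemma onorm_power2_le_sum_entries:
  fixes M :: "real^'n^'m"
  shows "(onorm ((*v) M))\<^sup>2 \<le> (\<Sum>i\<in>UNIV. \<Sum>j\<in>UNIV. (M $ i $ j)\<^sup>2)"
proof -
  let ?S = "\<Sum>i\<in>UNIV. \<Sum>j\<in>UNIV. (M $ i $ j)\<^sup>2"
  have "norm (M *v y) \<le> sqrt ?S * norm y" for y
  proof (rule power2_le_imp_le)
    have "(norm (M *v y))\<^sup>2 = (\<Sum>i\<in>UNIV. (\<Sum>j\<in>UNIV. M $ i $ j * y $ j)\<^sup>2)"
      by (simp add: norm_vec_power2 matrix_vector_mult_def)
    also have "\<dots> \<le> (\<Sum>i\<in>UNIV. (\<Sum>j\<in>UNIV. (M $ i $ j)\<^sup>2) * (\<Sum>j\<in>UNIV. (y $ j)\<^sup>2))"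
      by (intro sum_mono Cauchy_Schwarz_ineq_sum)
    also have "\<dots> = ?S * (norm y)\<^sup>2" by (simp add: norm_vec_power2 sum_distrib_right)
    also have "\<dots> = (sqrt ?S * norm y)\<^sup>2" by (simp add: power_mult_distrib sum_nonneg)
    finally show "(norm (M *v y))\<^sup>2 \<le> (sqrt ?S * norm y)\<^sup>2" .
  qed (simp add: sum_nonneg)
  then have "onorm ((*v) M) \<le> sqrt ?S" by (rule onorm_le)
  then have "(onorm ((*v) M))\<^sup>2 \<le> (sqrt ?S)\<^sup>2"
    by (intro power_mono onorm_pos_le matrix_vector_mul_bounded_linear)
  then show ?thesis by (simp add: sum_nonneg)
qed

section \<open>The Gram matrix of the normalized rows\<close>

lemma row_normalize_rows: "row i (normalize_rows A) = row i A /\<^sub>R norm (row i A)"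
  by (simp add: normalize_rows_def row_def vec_eq_iff)

lemma lower_gram_minus_one_nth:
  "lower_gram A $ i $ j - mat 1 $ i $ j =
    (if j < i then row i (normalize_rows A) \<bullet> row j (normalize_rows A) else 0)"
  by (simp add: lower_gram_def mat_def)

text \<open>Compares the trace of the Gram matrix with the number of its nonzero eigenvalues; expanding
  in an orthonormal basis of the row space avoids diagonalizing it.\<close>

lemma card_rows_le_rank_mult:
  fixes A :: "real^'n^'m"
  assumes "\<And>i. row i A \<noteq> 0"
    and "\<And>w. (norm (normalize_rows A *v w))\<^sup>2 \<le> l * (norm w)\<^sup>2"
  shows "real CARD('m) \<le> real (rank A) * l"
proof -
  let ?a = "\<lambda>i. row i (normalize_rows A)"
  obtain B where B: "B \<subseteq> span (rows A)" "pairwise orthogonal B" "\<And>v. v \<in> B \<Longrightarrow> norm v = 1"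
    "independent B" "card B = dim (span (rows A))" "span B = span (rows A)"
    using orthonormal_basis_subspace[OF subspace_span] by metis
  have fin: "finite B" using B(4) by (rule independent_imp_finite)
  have card: "card B = rank A" by (simp add: B(5) row_rank_def)
  \<comment> \<open>Parseval for a unit vector of the row space, in which \<open>B\<close> is an
    orthonormal basis.\<close>
  have "1 = (\<Sum>v\<in>B. (?a i \<bullet> v)\<^sup>2)" for i
  proof -
    have in_span: "?a i \<in> span B"
      unfolding B(6) row_normalize_rows by (intro span_mul span_base) (auto simp: rows_def)
    have eq: "(\<Sum>v\<in>B. (?a i \<bullet> v) *\<^sub>R v) = ?a i"
      by (rule orthonormal_basis_expand[OF B(2,3) in_span fin])
    have "1 = ?a i \<bullet> ?a i"
      using assms(1)[of i] by (simp add: row_normalize_rows dot_square_norm power2_eq_square)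
    also have "\<dots> = ?a i \<bullet> (\<Sum>v\<in>B. (?a i \<bullet> v) *\<^sub>R v)" by (simp add: eq)
    also have "\<dots> = (\<Sum>v\<in>B. (?a i \<bullet> v)\<^sup>2)" by (simp add: inner_sum_right power2_eq_square)
    finally show ?thesis .
  qed
  then have "real CARD('m) = (\<Sum>i\<in>(UNIV::'m set). \<Sum>v\<in>B. (?a i \<bullet> v)\<^sup>2)"
    by (metis (no_types, lifting) real_of_card sum.cong)
  also have "\<dots> = (\<Sum>v\<in>B. \<Sum>i\<in>UNIV. (?a i \<bullet> v)\<^sup>2)" by (rule sum.swap)
  also have "\<dots> = (\<Sum>v\<in>B. (norm (normalize_rows A *v v))\<^sup>2)"
    by (simp add: norm_vec_power2 matrix_vector_mul_component row_def)
  also have "\<dots> \<le> (\<Sum>v\<in>B. l)"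
    using assms(2) B(3) by (intro sum_mono) (metis mult.right_neutral one_power2)
  finally show ?thesis by (simp add: card)
qed

theorem lemma4:
  fixes A :: "real^'n^'m::{finite,linorder}"
  assumes "\<And>i. row i A \<noteq> 0"
  shows "(onorm ((*v) (lower_gram A - mat 1)))\<^sup>2
    \<le> min (\<Sum>(i, j) | i < j. (row i (normalize_rows A) \<bullet> row j (normalize_rows A))\<^sup>2)
           ((real_of_int \<lceil>log 2 (real (rank A))\<rceil> / 2 + 1)\<^sup>2
             * (largest_singular_value (normalize_rows A)) ^ 4)"
proof (rule min.boundedI)
  let ?a = "\<lambda>i. row i (normalize_rows A)" and ?M = "lower_gram A - mat 1"
  have "(onorm ((*v) ?M))\<^sup>2 \<le> (\<Sum>i\<in>UNIV. \<Sum>j\<in>UNIV. (?M $ i $ j)\<^sup>2)"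
    by (rule onorm_power2_le_sum_entries)
  also have "\<dots> = (\<Sum>i\<in>UNIV. \<Sum>j\<in>UNIV. if j < i then (?a i \<bullet> ?a j)\<^sup>2 else 0)"
    by (intro sum.cong refl) (simp add: lower_gram_minus_one_nth)
  \<comment> \<open>Exchanging the roles of the indices passes from the lower triangle to the pairs
    \<open>i < j\<close> of the claim.\<close>
  also have "\<dots> = (\<Sum>j\<in>UNIV. \<Sum>i\<in>UNIV. if j < i then (?a j \<bullet> ?a i)\<^sup>2 else 0)"
    by (subst sum.swap) (simp add: inner_commute cong: if_cong)
  also have "\<dots> = (\<Sum>p\<in>UNIV. if fst p < snd p then (?a (fst p) \<bullet> ?a (snd p))\<^sup>2 else 0)"
    by (simp add: sum.cartesian_product case_prod_beta)
  also have "\<dots> = (\<Sum>(i, j) | i < j. (?a i \<bullet> ?a j)\<^sup>2)"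
    by (simp add: case_prod_beta' flip: sum.inter_filter)
  finally show "(onorm ((*v) ?M))\<^sup>2 \<le> (\<Sum>(i, j) | i < j. (?a i \<bullet> ?a j)\<^sup>2)" .

  define l where "l = (largest_singular_value (normalize_rows A))\<^sup>2"
  have bound: "(norm (normalize_rows A *v w))\<^sup>2 \<le> l * (norm w)\<^sup>2" for w
    unfolding l_def by (rule largest_singular_value_bound)
  have comb: "(norm (\<Sum>i\<in>UNIV. w i *\<^sub>R ?a i))\<^sup>2 \<le> l * (\<Sum>i\<in>UNIV. (w i)\<^sup>2)" for w
  proof -
    have "transpose (normalize_rows A) *v (\<chi> i. w i) = (\<Sum>i\<in>UNIV. w i *\<^sub>R ?a i)"
      by (simp add: matrix_mult_sum scalar_mult_eq_scaleR)
    moreover have "(norm (\<chi> i. w i))\<^sup>2 = (\<Sum>i\<in>UNIV. (w i)\<^sup>2)"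
      by (simp add: norm_vec_power2)
    ultimately show ?thesis
      using transpose_mult_bound[OF bound, of "\<chi> i. w i"] by simp
  qed
  have unit: "norm (?a i) = 1" for i
    using assms[of i] by (simp add: row_normalize_rows)
  have trace: "real CARD('m) \<le> real (rank A) * l"
    by (rule card_rows_le_rank_mult[OF assms bound])
  \<comment> \<open>There is at least one row, so the trace inequality makes both factors positive;
    in particular the logarithm is never taken at \<open>0\<close>.\<close>
  have "0 < real (rank A) * l"
    using trace zero_less_card_finite[where 'a = 'm] by linarith
  then have pos: "0 < rank A" "0 < l"
    by (auto simp: zero_less_mult_iff)
  \<comment> \<open>\<open>nat\<close> truncates nothing, as \<open>rank A\<close> is at least
    \<open>1\<close>. For rank one, \<open>k = 0\<close> and no merge takes place.\<close>
  define k where "k = nat \<lceil>log 2 (real (rank A))\<rceil>"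
  have "0 \<le> log 2 (real (rank A))" using pos by simp
  then have k: "real_of_int \<lceil>log 2 (real (rank A))\<rceil> = real k"
    unfolding k_def by simp
  have "log 2 (real (rank A)) \<le> real k" unfolding k[symmetric] by simp
  then have "real (rank A) \<le> real (2 ^ k)"
    using pos by (simp add: log_le_iff powr_realpow)
  then have rk: "rank A \<le> 2 ^ k" by linarith
  have "onorm ((*v) ?M) \<le> (real k / 2 + 1) * l"
  proof (rule onorm_le_of_inner_bound)
    fix x y :: "real^'m::{finite,linorder}"
    have "x \<bullet> (?M *v y) = (\<Sum>i\<in>UNIV. \<Sum>j\<in>UNIV. x $ i * (?M $ i $ j * y $ j))"
      by (simp add: inner_vec_def matrix_vector_mult_def sum_distrib_left)
    also have "\<dots> = (\<Sum>i\<in>UNIV. \<Sum>j\<in>UNIV. if j < i then x $ i * y $ j * (?a i \<bullet> ?a j) else 0)"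
      by (intro sum.cong refl) (simp add: lower_gram_minus_one_nth)
    also have "\<dots> \<le> (real k / 2 + 1) * l / 2 * (\<Sum>i\<in>UNIV. (x $ i)\<^sup>2 + (y $ i)\<^sup>2)"
      using pos by (intro strictly_lower_sum_bound[where r = "rank A"] comb unit trace rk) auto
    also have "(\<Sum>i\<in>UNIV. (x $ i)\<^sup>2 + (y $ i)\<^sup>2) = (norm x)\<^sup>2 + (norm y)\<^sup>2"
      by (simp add: norm_vec_power2 sum.distrib)
    finally show "x \<bullet> (?M *v y) \<le> (real k / 2 + 1) * l / 2 * ((norm x)\<^sup>2 + (norm y)\<^sup>2)" .
  qed (use pos in \<open>simp add: add_nonneg_pos\<close>)
  then have "(onorm ((*v) ?M))\<^sup>2 \<le> ((real k / 2 + 1) * l)\<^sup>2"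
    by (intro power_mono onorm_pos_le matrix_vector_mul_bounded_linear)
  then show "(onorm ((*v) ?M))\<^sup>2 \<le> (real_of_int \<lceil>log 2 (real (rank A))\<rceil> / 2 + 1)\<^sup>2
      * (largest_singular_value (normalize_rows A)) ^ 4"
    unfolding k l_def by (simp only: power_mult_distrib power_mult[symmetric]) simp
qed

end
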